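(* Let $B$ be a bounded positive operator on a complex Hilbert space $\mathscr{H}$. Then the following are equivalent: (i) $\operatorname{ran}B$ is closed; (ii) for all $A\in\mathbf{B}_+(\mathscr{H})$: $A_{\ll,B}\leq_{\mathrm{d}}B$; (iii) for all $A\in\mathbf{B}_+(\mathscr{H})$: $\mathbf{D}_BA\leq_{\mathrm{d}}B$. If any of (i)--(iii) holds, then $\mathbf{D}_BA=A_{\ll,B}$ for all $A\in\mathbf{B}_+(\mathscr{H})$.
   Context: $\mathscr{H}$ is a complex Hilbert space with inner product $(\cdot\,|\,\cdot)$ and $\mathbf{B}_+(\mathscr{H})$ is the set of bounded positive operators on $\mathscr{H}$, with $A\leq B$ iff $(Ax\,|\,x)\leq(Bx\,|\,x)$ for all $x$. $A\leq_{\mathrm{d}}B$ ($A$ is dominated by $B$) means $A\leq cB$ for some constant $c$. For $A,B\in\mathbf{B}_+(\mathscr{H})$, $A_{\ll,B}\in\mathbf{B}_+(\mathscr{H})$ is the operator with $(A_{\ll,B}x\,|\,x)=\inf_{y\in\ker B}(A(x-y)\,|\,x-y)$ for all $x\in\mathscr{H}$. The parallel sum $A:B\in\mathbf{B}_+(\mathscr{H})$ is the operator with $((A:B)x\,|\,x)=\inf_{y\in\mathscr{H}}\{(A(x-y)\,|\,x-y)+(By\,|\,y)\}$ for all $x\in\mathscr{H}$. $\mathbf{D}_BA:=\sup_{n\in\mathbb{N}}(A:(nB))$ (Ando's strongly $B$-absolutely continuous part of $A$), i.e. the operator with $(\mathbf{D}_BA\,x\,|\,x)=\sup_{n\in\mathbb{N}}((A:(nB))x\,|\,x)$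 for all $x\in\mathscr{H}$. *)

theory Defs
  imports "HOL-Analysis.Analysis"
begin

text \<open>
  Complex Hilbert spaces. The classes \<^class>\<open>real_inner\<close> and \<^class>\<open>complete_space\<close> supply the
  underlying real Hilbert space, hence the norm, the topology and completeness. The complex
  structure is tied to it by \<open>scaleR_scaleC\<close> and \<open>inner_eq_Re_cinner\<close>; the latter makes the norm
  the one induced by \<open>cinner\<close>, see \<open>cinner_self\<close> below. The inner product is linear in its first
  argument.
\<close>

class complex_hilbert_space = real_inner + complete_space +
  fixes scaleC :: "complex \<Rightarrow> 'a \<Rightarrow> 'a"  (infixr \<open>*\<^sub>C\<close> 75)
    and cinner :: "'a \<Rightarrow> 'a \<Rightarrow> complex"
  assumes scaleC_add_right: "c *\<^sub>C (x + y) = c *\<^sub>C x + c *\<^sub>C y"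
    and scaleC_add_left: "(c + d) *\<^sub>C x = c *\<^sub>C x + d *\<^sub>C x"
    and scaleC_scaleC: "c *\<^sub>C (d *\<^sub>C x) = (c * d) *\<^sub>C x"
    and scaleR_scaleC: "r *\<^sub>R x = complex_of_real r *\<^sub>C x"
    and cinner_commute: "cinner x y = cnj (cinner y x)"
    and cinner_add_left: "cinner (x + y) z = cinner x z + cinner y z"
    and cinner_scaleC_left: "cinner (c *\<^sub>C x) y = c * cinner x y"
    and inner_eq_Re_cinner: "inner x y = Re (cinner x y)"

lemma cinner_self:
  fixes x :: "'a::complex_hilbert_space"
  shows "cinner x x = complex_of_real ((norm x)\<^sup>2)"
proof (rule complex_eqI)
  show "Re (cinner x x) = Re (complex_of_real ((norm x)\<^sup>2))"
    using inner_eq_Re_cinner[of x x] by (simp add: power2_norm_eq_inner)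
  have "Im (cinner x x) = - Im (cinner x x)"
    using arg_cong[OF cinner_commute[of x x], of Im] by simp
  then show "Im (cinner x x) = Im (complex_of_real ((norm x)\<^sup>2))"
    by simp
qed

instantiation complex :: complex_hilbert_space
begin

definition scaleC_complex :: "complex \<Rightarrow> complex \<Rightarrow> complex"
  where "scaleC_complex c x = c * x"

definition cinner_complex :: "complex \<Rightarrow> complex \<Rightarrow> complex"
  where "cinner_complex x y = x * cnj y"

instance
  by standard
    (auto simp: scaleC_complex_def cinner_complex_def algebra_simps scaleR_conv_of_real
      inner_complex_def)

end

definition bounded_clinear_op :: "('a::complex_hilbert_space \<Rightarrow> 'a) \<Rightarrow> bool"
  where "bounded_clinear_op A \<longleftrightarrow> bounded_linear A \<and> (\<forall>c x. A (c *\<^sub>C x) = c *\<^sub>C A x)"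

definition bounded_positive :: "('a::complex_hilbert_space \<Rightarrow> 'a) set"  (\<open>\<B>\<^sub>+\<close>)
  where "\<B>\<^sub>+ = {A. bounded_clinear_op A \<and> (\<forall>x. cinner (A x) x \<in> \<real>\<^sub>\<ge>\<^sub>0)}"

text \<open>
  On \<open>\<B>\<^sub>+\<close> the number \<open>cinner (A x) x\<close> is real, so taking its real part only converts its type.
\<close>

definition quad :: "('a::complex_hilbert_space \<Rightarrow> 'a) \<Rightarrow> 'a \<Rightarrow> real"
  where "quad A x = Re (cinner (A x) x)"

definition op_le :: "('a::complex_hilbert_space \<Rightarrow> 'a) \<Rightarrow> ('a \<Rightarrow> 'a) \<Rightarrow> bool"
  where "op_le A B \<longleftrightarrow> (\<forall>x. quad A x \<le> quad B x)"

definition dominated :: "('a::complex_hilbert_space \<Rightarrow> 'a) \<Rightarrow> ('a \<Rightarrow> 'a) \<Rightarrow> bool"  (infix \<open>\<le>\<^sub>d\<close> 50)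
  where "A \<le>\<^sub>d B \<longleftrightarrow> (\<exists>c::real. op_le A (\<lambda>x. c *\<^sub>R B x))"

definition op_ker :: "('a::complex_hilbert_space \<Rightarrow> 'a) \<Rightarrow> 'a set"
  where "op_ker B = {x. B x = 0}"

text \<open>
  A bounded positive operator on a complex Hilbert space is determined by its quadratic form, so
  the descriptions below have at most one solution. For \<open>A, B \<in> \<B>\<^sub>+\<close> the infima are over nonempty
  sets bounded below by \<open>0\<close>, and the suprema over sets bounded above by \<open>quad A x\<close>.
\<close>

definition ll_part :: "('a::complex_hilbert_space \<Rightarrow> 'a) \<Rightarrow> ('a \<Rightarrow> 'a) \<Rightarrow> 'a \<Rightarrow> 'a"
  where "ll_part A B =
    (THE T. T \<in> \<B>\<^sub>+ \<and> (\<forall>x. quad T x = (INF y\<in>op_ker B. quad A (x - y))))"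

definition parallel_sum :: "('a::complex_hilbert_space \<Rightarrow> 'a) \<Rightarrow> ('a \<Rightarrow> 'a) \<Rightarrow> 'a \<Rightarrow> 'a"
  where "parallel_sum A B =
    (THE T. T \<in> \<B>\<^sub>+ \<and> (\<forall>x. quad T x = (INF y. quad A (x - y) + quad B y)))"

text \<open>The Ando part \<open>D\<^sub>B A\<close>; as in that notation, \<open>B\<close> is the first argument.\<close>

definition ando_part :: "('a::complex_hilbert_space \<Rightarrow> 'a) \<Rightarrow> ('a \<Rightarrow> 'a) \<Rightarrow> 'a \<Rightarrow> 'a"
  where "ando_part B A =
    (THE T. T \<in> \<B>\<^sub>+ \<and>
      (\<forall>x. quad T x = (SUP n::nat. quad (parallel_sum A (\<lambda>z. real n *\<^sub>R B z)) x)))"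

end

theory Submission
  imports Defs
begin

text \<open>
  The infimum of a positive quadratic form over part of its variables is again a quadratic form,
  because it inherits the parallelogram law. By the Jordan--von Neumann theorem and the Riesz
  representation it is then the form of a unique bounded positive operator, so the operators
  \<open>ll_part\<close>, \<open>parallel_sum\<close> and \<open>ando_part\<close> exist and have the expected forms.

  If \<open>range B\<close> is closed, then \<open>range B\<close> and \<open>op_ker B\<close> span the space, so the vectors orthogonal
  to \<open>op_ker B\<close> with \<open>quad B x \<le> 1\<close> are weakly bounded, hence bounded. So the squared distance to
  \<open>op_ker B\<close> is at most a multiple of \<open>quad B\<close>, and it dominates \<open>ll_part A B\<close> up to a constant.
  Conversely, for \<open>A\<close> the identity both parts are the projection onto the orthogonal complement of
  \<open>op_ker B\<close>; its domination by \<open>B\<close> says that \<open>B\<close> is bounded below there, which makes the range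
  closed.
\<close>

section \<open>Real Hilbert spaces\<close>

text \<open>A bound in terms of the smaller index is what a minimising sequence provides. It
  suffices because any two late terms can be compared through the fixed term
  \<open>y N\<close>.\<close>

lemma Cauchy_of_norm_le:
  fixes y :: "nat \<Rightarrow> 'a::real_normed_vector"
  assumes le: "\<And>m n. m \<le> n \<Longrightarrow> (norm (y m - y n))\<^sup>2 \<le> e m"
    and e: "e \<longlonglongrightarrow> 0"
  shows "Cauchy y"
proof (rule metric_CauchyI)
  fix r :: real
  assume "0 < r"
  then have "(r/2)\<^sup>2 > 0" by simp
  then have "\<forall>\<^sub>F n in sequentially. e n < (r/2)\<^sup>2"
    using e by (rule order_tendstoD(2)[rotated])
  then obtain N where "e N < (r/2)\<^sup>2"
    by (auto simp: eventually_sequentially)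
  then have *: "norm (y N - y n) < r / 2" if "N \<le> n" for n
    using le[OF that] \<open>0 < r\<close> by (intro power2_less_imp_less[of _ "r/2"]) auto
  show "\<exists>M. \<forall>m\<ge>M. \<forall>n\<ge>M. dist (y m) (y n) < r"
  proof (intro exI allI impI)
    fix m n assume "N \<le> m" "N \<le> n"
    then show "dist (y m) (y n) < r"
      using dist_triangle_half_r[of "y N" "y m" r "y n"] *[of m] *[of n]
      by (simp add: dist_norm)
  qed
qed

lemma parallelogram:
  fixes u v :: "'a::real_inner"
  shows "(norm (u + v))\<^sup>2 + (norm (u - v))\<^sup>2 = 2 * (norm u)\<^sup>2 + 2 * (norm v)\<^sup>2"
  by (simp add: power2_norm_eq_inner inner_simps inner_commute)

text \<open>The parallelogram law for \<open>x - a\<close> and \<open>x - b\<close>. In this form it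
  shows that near-minimisers of the distance to \<open>x\<close> are close to each other, since
  their midpoint cannot be much better than either.\<close>

lemma norm_diff_midpoint:
  fixes x a b :: "'a::real_inner"
  shows "(norm (a - b))\<^sup>2
    = 2 * (norm (x - a))\<^sup>2 + 2 * (norm (x - b))\<^sup>2 - 4 * (norm (x - (1/2) *\<^sub>R (a + b)))\<^sup>2"
proof -
  have "(x - a) + (x - b) = 2 *\<^sub>R (x - (1/2) *\<^sub>R (a + b))"
    by (simp add: algebra_simps scaleR_2)
  then have "(norm ((x - a) + (x - b)))\<^sup>2 = 4 * (norm (x - (1/2) *\<^sub>R (a + b)))\<^sup>2"
    by (simp add: power_mult_distrib)
  moreover have "norm ((x - a) - (x - b)) = norm (a - b)"
    by (simp add: norm_minus_commute)
  ultimately show ?thesis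
    using parallelogram[of "x - a" "x - b"] by simp
qed

text \<open>A sequence in \<open>V\<close> minimising the distance to \<open>x\<close> is Cauchy by
  the midpoint identity. Its limit \<open>k\<close> is a closest point, and moving \<open>k\<close>
  along \<open>v\<close> cannot shorten the distance, which forces orthogonality.\<close>

lemma orthogonal_projection_exists:
  fixes V :: "'a::{real_inner, complete_space} set"
  assumes V: "subspace V" "closed V"
  shows "\<exists>k\<in>V. \<forall>v\<in>V. inner (x - k) v = 0"
proof -
  define d where "d = (INF v\<in>V. (norm (x - v))\<^sup>2)"
  have bdd: "bdd_below ((\<lambda>v. (norm (x - v))\<^sup>2) ` V)"
    by (intro bdd_belowI[of _ 0]) auto
  have ne: "V \<noteq> {}" using V subspace_0 by blast
  have d_le: "d \<le> (norm (x - v))\<^sup>2" if "v \<in> V" for v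
    unfolding d_def using bdd that by (rule cINF_lower)
  have "\<exists>v\<in>V. (norm (x - v))\<^sup>2 < d + 1 / real (Suc n)" for n
    using cINF_less_iff[OF ne bdd, of "d + 1 / real (Suc n)"] d_def by simp
  then obtain y where y: "\<And>n. y n \<in> V" "\<And>n. (norm (x - y n))\<^sup>2 < d + 1 / real (Suc n)"
    by metis
  have "Cauchy y"
  proof (rule Cauchy_of_norm_le)
    fix m n :: nat
    assume "m \<le> n"
    \<comment> \<open>Convexity of \<open>V\<close> keeps the midpoint admissible, so its squared
      distance to \<open>x\<close> is at least \<open>d\<close>.\<close>
    have "(1/2) *\<^sub>R (y m + y n) \<in> V"
      using V y by (intro subspace_scale subspace_add)
    then have "(norm (y m - y n))\<^sup>2 \<le> 2 / real (Suc m) + 2 / real (Suc n)"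
      using norm_diff_midpoint[of "y m" "y n" x] d_le y(2)[of m] y(2)[of n] by fastforce
    also have "\<dots> \<le> 4 * (1 / real (Suc m))"
      using frac_le[of 2 2 "real (Suc m)" "real (Suc n)"] \<open>m \<le> n\<close> by simp
    finally show "(norm (y m - y n))\<^sup>2 \<le> 4 * (1 / real (Suc m))" .
  next
    show "(\<lambda>m. 4 * (1 / real (Suc m))) \<longlonglongrightarrow> 0"
      using tendsto_mult_left[OF LIMSEQ_inverse_real_of_nat, of 4] by (simp add: inverse_eq_divide)
  qed
  then obtain k where k: "y \<longlonglongrightarrow> k"
    using Cauchy_convergent convergent_def by blast
  have "k \<in> V"
    using V(2) y(1) k closed_sequentially by blast
  have "(norm (x - k))\<^sup>2 \<le> d + 0"
  proof (rule LIMSEQ_le)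
    show "(\<lambda>n. (norm (x - y n))\<^sup>2) \<longlonglongrightarrow> (norm (x - k))\<^sup>2"
      using k by (intro tendsto_intros)
    show "(\<lambda>n. d + 1 / real (Suc n)) \<longlonglongrightarrow> d + 0"
      using LIMSEQ_inverse_real_of_nat by (intro tendsto_add tendsto_const) (simp add: inverse_eq_divide)
    show "\<exists>N. \<forall>n\<ge>N. (norm (x - y n))\<^sup>2 \<le> d + 1 / real (Suc n)"
      using y(2) less_imp_le by blast
  qed
  then have min: "(norm (x - k))\<^sup>2 \<le> (norm (x - v))\<^sup>2" if "v \<in> V" for v
    using d_le[OF that] by linarith
  have "inner (x - k) v = 0" if "v \<in> V" for v
  proof (rule ccontr)
    let ?a = "inner (x - k) v"
    assume "?a \<noteq> 0"
    then have "v \<noteq> 0" by auto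
    \<comment> \<open>This \<open>t\<close> minimises the squared distance from \<open>x\<close> to
      \<open>k + t *\<^sub>R v\<close>; a nonzero \<open>?a\<close> would make the gain strictly
      positive.\<close>
    define t where "t = ?a / inner v v"
    have "inner v v > 0" using \<open>v \<noteq> 0\<close> by simp
    have "k + t *\<^sub>R v \<in> V"
      using V \<open>k \<in> V\<close> that by (intro subspace_add subspace_scale)
    from min[OF this] have "0 \<le> t * t * inner v v - 2 * t * ?a"
      by (simp add: power2_norm_eq_inner inner_simps inner_commute algebra_simps)
    also have "\<dots> = - (?a\<^sup>2 / inner v v)"
      using \<open>inner v v > 0\<close> by (simp add: t_def field_simps power2_eq_square)
    also have "\<dots> < 0"
      using \<open>inner v v > 0\<close> \<open>?a \<noteq> 0\<close> by simp
    finally show False by simp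
  qed
  then show ?thesis using \<open>k \<in> V\<close> by blast
qed

text \<open>For nonzero \<open>f\<close>, a vector \<open>w\<close> orthogonal to the kernel with
  \<open>f w\<close> nonzero decides everything: each \<open>x\<close> differs from a multiple of
  \<open>w\<close> by an element of the kernel.\<close>

lemma Riesz_representation:
  fixes f :: "'a::{real_inner, complete_space} \<Rightarrow> real"
  assumes f: "bounded_linear f"
  shows "\<exists>a. \<forall>x. inner a x = f x"
proof (cases "\<forall>x. f x = 0")
  case True
  then show ?thesis by (intro exI[of _ 0]) simp
next
  case False
  then obtain z where z: "f z \<noteq> 0" by blast
  interpret f: bounded_linear f by (fact f)
  have "closed {x. f x = 0}"
    by (intro closed_Collect_eq f.continuous_on continuous_intros)
  moreover have "subspace {x. f x = 0}"
    by (simp add: subspace_def f.zero f.add f.scaleR)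
  ultimately obtain k where k: "f k = 0" "\<And>v. f v = 0 \<Longrightarrow> inner (z - k) v = 0"
    using orthogonal_projection_exists[of "{x. f x = 0}" z] by auto
  define w where "w = z - k"
  have fw: "f w = f z" using k by (simp add: w_def f.diff)
  then have "w \<noteq> 0" using z f.zero by auto
  have "inner ((f w / inner w w) *\<^sub>R w) x = f x" for x
  proof -
    have "f (x - (f x / f w) *\<^sub>R w) = 0"
      using z fw by (simp add: f.diff f.scaleR)
    then have "inner w (x - (f x / f w) *\<^sub>R w) = 0"
      unfolding w_def by (rule k(2))
    then have "inner w x = (f x / f w) * inner w w"
      by (simp add: inner_simps)
    then show ?thesis
      using z fw \<open>w \<noteq> 0\<close> by simp
  qed
  then show ?thesis by blast
qed

text \<open>The uniform boundedness principle for the functionals given by \<open>K\<close>. The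
  closed sets \<open>E n\<close> cover the space, so by Baire one of them contains a ball, and a
  bound on a ball bounds the norms.\<close>

lemma weakly_bounded_imp_bounded:
  fixes K :: "'a::{real_inner, complete_space} set"
  assumes K: "\<And>z. \<exists>M. \<forall>x\<in>K. \<bar>inner x z\<bar> \<le> M"
  shows "bounded K"
proof -
  define E where "E n = {z. \<forall>x\<in>K. \<bar>inner x z\<bar> \<le> real n}" for n
  have E_closed: "closed (E n)" for n
  proof -
    have "E n = (\<Inter>x\<in>K. {z. \<bar>inner x z\<bar> \<le> real n})" by (auto simp: E_def)
    then show ?thesis by (auto intro!: closed_INT closed_Collect_le continuous_intros)
  qed
  have "\<Union> (range E) = UNIV"
  proof -
    have "\<exists>n. z \<in> E n" for z
    proof -
      obtain M where "\<forall>x\<in>K. \<bar>inner x z\<bar> \<le> M" using K by blast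
      moreover obtain n where "M \<le> real n" using real_arch_simple by blast
      ultimately have "z \<in> E n" unfolding E_def by force
      then show ?thesis ..
    qed
    then show ?thesis by blast
  qed
  moreover have "completely_metrizable_space (euclidean :: 'a topology)"
    by (rule completely_metrizable_space_euclidean)
  ultimately obtain n where "interior (E n) \<noteq> {}"
    using Baire_category_alt[of "euclidean :: 'a topology" "range E"] E_closed
    by (force simp: closed_closedin[symmetric])
  then obtain z r where r: "r > 0" "ball z r \<subseteq> E n"
    by (metis ex_in_conv mem_interior)
  have "norm x \<le> 4 * real n / r" if "x \<in> K" for x
  proof (cases "x = 0")
    case False
    \<comment> \<open>The vector \<open>x\<close> rescaled to length \<open>r / 2\<close>, so that
      \<open>z + u\<close> stays in the ball while \<open>inner x u\<close> is a fixed multiple of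
      \<open>norm x\<close>.\<close>
    define u where "u = (r / (2 * norm x)) *\<^sub>R x"
    have "norm u < r" using r False by (simp add: u_def)
    then have "z + u \<in> E n" "z \<in> E n" using r by (auto simp: dist_norm)
    then have "\<bar>inner x (z + u)\<bar> \<le> real n" "\<bar>inner x z\<bar> \<le> real n"
      using that by (auto simp: E_def)
    then have "inner x u \<le> 2 * real n" by (simp add: inner_add_right)
    moreover have "inner x u = r / 2 * norm x"
      using False by (simp add: u_def power2_norm_eq_inner[symmetric] power2_eq_square)
    ultimately show ?thesis using r by (simp add: field_simps)
  qed (use r in simp)
  then show ?thesis unfolding bounded_iff by blast
qed

section \<open>Bounded positive operators and their quadratic forms\<close>

text \<open>The imaginary part of \<open>cinner\<close> is a real inner product with one argument
  rotated by \<open>\<i>\<close>. This lets real Hilbert space arguments handle the complex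
  structure.\<close>

lemma inner_scaleC_i:
  fixes x y :: "'a::complex_hilbert_space"
  shows "inner (\<i> *\<^sub>C x) y = - Im (cinner x y)"
    and "inner x (\<i> *\<^sub>C y) = Im (cinner x y)"
proof -
  show *: "inner (\<i> *\<^sub>C x) y = - Im (cinner x y)" for x y :: 'a
    by (simp add: inner_eq_Re_cinner cinner_scaleC_left)
  show "inner x (\<i> *\<^sub>C y) = Im (cinner x y)"
    using *[of y x] cinner_commute[of x y] by (simp add: inner_commute)
qed

lemma cinner_eq_inner:
  fixes x y :: "'a::complex_hilbert_space"
  shows "cinner x y = Complex (inner x y) (inner x (\<i> *\<^sub>C y))"
  by (rule complex_eqI) (simp_all only: inner_scaleC_i(2) inner_eq_Re_cinner[of x y] complex.sel)

lemma scaleC_i_i: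
  fixes x :: "'a::complex_hilbert_space"
  shows "\<i> *\<^sub>C \<i> *\<^sub>C x = - x"
  using scaleR_scaleC[of "-1" x] by (simp add: scaleC_scaleC)

lemma scaleC_zero_right: "c *\<^sub>C (0 :: 'a::complex_hilbert_space) = 0"
  using scaleC_add_right[of c "0::'a" 0] by simp

lemma scaleC_diff_right: "c *\<^sub>C ((x :: 'a::complex_hilbert_space) - y) = c *\<^sub>C x - c *\<^sub>C y"
  using scaleC_add_right[of c "x - y" y] by (simp add: algebra_simps)

lemma scaleC_eq:
  fixes x :: "'a::complex_hilbert_space"
  shows "c *\<^sub>C x = Re c *\<^sub>R x + Im c *\<^sub>R (\<i> *\<^sub>C x)"
  using complex_eq[of c]
  by (metis scaleC_add_left scaleC_scaleC scaleR_scaleC mult.commute)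

text \<open>Over the reals, complex linearity amounts to commuting with \<open>\<i>\<close>, and the
  last condition says that the imaginary part of \<open>cinner (T x) x\<close> vanishes.\<close>

lemma bounded_positiveI:
  fixes T :: "'a::complex_hilbert_space \<Rightarrow> 'a"
  assumes "bounded_linear T" "\<And>x. T (\<i> *\<^sub>C x) = \<i> *\<^sub>C T x"
    and "\<And>x. inner (T x) x \<ge> 0" "\<And>x. inner (T x) (\<i> *\<^sub>C x) = 0"
  shows "T \<in> \<B>\<^sub>+"
proof -
  interpret T: bounded_linear T by fact
  have "T (c *\<^sub>C x) = c *\<^sub>C T x" for c x
    by (simp add: scaleC_eq[of c] T.add T.scaleR assms(2))
  moreover have "cinner (T x) x \<in> \<real>\<^sub>\<ge>\<^sub>0" for x
    by (simp add: complex_nonneg_Reals_iff cinner_eq_inner assms)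
  ultimately show ?thesis
    using assms(1) by (simp add: bounded_positive_def bounded_clinear_op_def)
qed

lemma bounded_positiveD:
  fixes T :: "'a::complex_hilbert_space \<Rightarrow> 'a"
  assumes "T \<in> \<B>\<^sub>+"
  shows "bounded_linear T" "T (c *\<^sub>C x) = c *\<^sub>C T x" "inner (T x) x \<ge> 0"
    "inner (T x) (\<i> *\<^sub>C x) = 0"
proof -
  show "bounded_linear T" "T (c *\<^sub>C x) = c *\<^sub>C T x"
    using assms by (auto simp: bounded_positive_def bounded_clinear_op_def)
  have "cinner (T x) x \<in> \<real>\<^sub>\<ge>\<^sub>0"
    using assms by (auto simp: bounded_positive_def)
  then show "inner (T x) x \<ge> 0" "inner (T x) (\<i> *\<^sub>C x) = 0"
    by (simp_all add: complex_nonneg_Reals_iff cinner_eq_inner)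
qed

lemma quad_eq_inner: "quad T x = inner (T x) x"
  by (simp add: quad_def inner_eq_Re_cinner)

text \<open>Symmetry comes from the form being real: polarise
  \<open>inner (T x) (\<i> *\<^sub>C x) = 0\<close>, then replace \<open>x\<close> by
  \<open>\<i> *\<^sub>C x\<close>.\<close>

lemma bounded_positive_sym:
  fixes T :: "'a::complex_hilbert_space \<Rightarrow> 'a"
  assumes T: "T \<in> \<B>\<^sub>+"
  shows "inner (T x) y = inner x (T y)"
proof -
  interpret T: bounded_linear T by (rule bounded_positiveD[OF T])
  have *: "inner (T x) (\<i> *\<^sub>C y) + inner (T y) (\<i> *\<^sub>C x) = 0" for x y
    using bounded_positiveD(4)[OF T, of "x + y"] bounded_positiveD(4)[OF T, of x]
      bounded_positiveD(4)[OF T, of y]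
    by (simp add: T.add scaleC_add_right inner_simps)
  have "inner (T (\<i> *\<^sub>C x)) (\<i> *\<^sub>C y) = inner (T x) y"
    by (simp add: bounded_positiveD(2)[OF T] inner_scaleC_i(2) cinner_scaleC_left inner_eq_Re_cinner[of "T x"])
  with *[of "\<i> *\<^sub>C x" y] have "inner (T x) y = inner (T y) x"
    by (simp add: scaleC_i_i)
  then show ?thesis by (simp add: inner_commute)
qed

lemma quad_add:
  fixes T :: "'a::complex_hilbert_space \<Rightarrow> 'a"
  assumes T: "T \<in> \<B>\<^sub>+"
  shows "quad T (x + y) = quad T x + quad T y + 2 * inner (T x) y"
proof -
  interpret T: bounded_linear T by (rule bounded_positiveD[OF T])
  show ?thesis
    using bounded_positive_sym[OF T, of y x]
    by (simp add: quad_eq_inner T.add inner_simps inner_commute)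
qed

lemma quad_scaleR:
  fixes T :: "'a::complex_hilbert_space \<Rightarrow> 'a"
  assumes T: "T \<in> \<B>\<^sub>+"
  shows "quad T (r *\<^sub>R x) = r\<^sup>2 * quad T x"
proof -
  interpret T: bounded_linear T by (rule bounded_positiveD[OF T])
  show ?thesis by (simp add: quad_eq_inner T.scaleR power2_eq_square)
qed

lemma quad_diff:
  fixes T :: "'a::complex_hilbert_space \<Rightarrow> 'a"
  assumes T: "T \<in> \<B>\<^sub>+"
  shows "quad T (x - y) = quad T x + quad T y - 2 * inner (T x) y"
  using quad_add[OF T, of x "- y"] quad_scaleR[OF T, of "-1" y] by simp

lemma quad_nonneg: "T \<in> \<B>\<^sub>+ \<Longrightarrow> 0 \<le> quad T x"
  by (simp add: quad_eq_inner bounded_positiveD)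

text \<open>Cauchy-Schwarz with the arithmetic mean in place of the geometric one; nonnegativity at
  \<open>x + y\<close> and \<open>x - y\<close> gives it directly.\<close>

lemma inner_le_quad:
  fixes T :: "'a::complex_hilbert_space \<Rightarrow> 'a"
  assumes T: "T \<in> \<B>\<^sub>+"
  shows "2 * \<bar>inner (T x) y\<bar> \<le> quad T x + quad T y"
  using quad_nonneg[OF T, of "x + y"] quad_nonneg[OF T, of "x - y"]
  by (simp add: quad_add[OF T] quad_diff[OF T])

lemma quad_eq_0_iff:
  fixes T :: "'a::complex_hilbert_space \<Rightarrow> 'a"
  assumes T: "T \<in> \<B>\<^sub>+"
  shows "quad T x = 0 \<longleftrightarrow> T x = 0"
proof
  assume q: "quad T x = 0"
  define a b where "a = inner (T x) (T x)" and "b = quad T (T x)"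
  have b: "b \<ge> 0" using quad_nonneg[OF T] by (simp add: b_def)
  have a: "a \<ge> 0" by (simp add: a_def)
  \<comment> \<open>Testing \<open>inner_le_quad\<close> with \<open>r *\<^sub>R T x\<close> bounds
    a term linear in \<open>r\<close> by a quadratic one, so a small \<open>r\<close> is wanted:
    this one satisfies \<open>r * b \<le> a\<close>, and the added 1 keeps the denominator
    positive.\<close>
  define r where "r = a / (b + 1)"
  have r: "r \<ge> 0" "r * b \<le> a" using a b by (simp_all add: r_def field_simps)
  have "2 * (r * a) \<le> r * (r * b)"
    using inner_le_quad[OF T, of x "r *\<^sub>R T x"] q a r(1)
    by (simp add: quad_scaleR[OF T] a_def[symmetric] b_def[symmetric] power2_eq_square)
  also have "\<dots> \<le> r * a" using r by (intro mult_left_mono)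
  finally have "a * a / (b + 1) \<le> 0" by (simp add: r_def)
  then have "a * a \<le> 0" using b by (simp add: divide_le_0_iff)
  then have "a = 0" by (metis antisym zero_le_square mult_eq_0_iff)
  then show "T x = 0" by (simp add: a_def)
next
  assume "T x = 0"
  then show "quad T x = 0" by (simp add: quad_eq_inner)
qed

section \<open>Quadratic forms and the operators that represent them\<close>

text \<open>These laws characterise the forms of bounded positive operators. They mention only
  values of \<open>q\<close>, not a bilinear form, so that they can be checked directly for infima
  and limits; invariance under \<open>\<i>\<close> encodes complex linearity.\<close>

definition hilbert_form :: "('a::complex_hilbert_space \<Rightarrow> real) \<Rightarrow> bool"
  where "hilbert_form q \<longleftrightarrow>
    (\<forall>x y. q (x + y) + q (x - y) = 2 * q x + 2 * q y) \<and> (\<forall>r x. q (r *\<^sub>R x) = r\<^sup>2 * q x) \<and>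
    (\<forall>x. q (\<i> *\<^sub>C x) = q x) \<and> (\<forall>x. 0 \<le> q x) \<and> (\<exists>M. \<forall>x. q x \<le> M * (norm x)\<^sup>2)"

lemma hilbert_form_quad:
  fixes T :: "'a::complex_hilbert_space \<Rightarrow> 'a"
  assumes T: "T \<in> \<B>\<^sub>+"
  shows "hilbert_form (quad T)"
proof -
  interpret T: bounded_linear T by (rule bounded_positiveD[OF T])
  have "quad T (\<i> *\<^sub>C x) = quad T x" for x
    by (simp add: quad_eq_inner bounded_positiveD(2)[OF T] inner_scaleC_i(2) cinner_scaleC_left
        inner_eq_Re_cinner[of "T x"])
  moreover have "quad T x \<le> onorm T * (norm x)\<^sup>2" for x
  proof -
    have "quad T x \<le> norm (T x) * norm x"
      by (simp add: quad_eq_inner norm_cauchy_schwarz)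
    also have "\<dots> \<le> onorm T * norm x * norm x"
      by (intro mult_right_mono onorm T.bounded_linear_axioms) auto
    finally show ?thesis by (simp add: power2_eq_square mult.assoc)
  qed
  ultimately show ?thesis
    unfolding hilbert_form_def
    by (auto simp: quad_add[OF T] quad_diff[OF T] quad_scaleR[OF T] quad_nonneg[OF T])
qed

text \<open>After subtracting the linear candidate, the additive remainder \<open>h\<close> vanishes
  at the integers, hence is bounded on the whole line by its bound on fractional parts. As
  \<open>h (n * t) = n * h t\<close>, a bounded \<open>h\<close> must be zero.\<close>

lemma additive_bounded_linear_real:
  fixes g :: "real \<Rightarrow> real"
  assumes add: "\<And>s t. g (s + t) = g s + g t"
    and bd: "\<And>t. 0 \<le> t \<Longrightarrow> t \<le> 1 \<Longrightarrow> \<bar>g t\<bar> \<le> M"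
  shows "g t = t * g 1"
proof -
  define h where "h s = g s - s * g 1" for s
  have h_add: "h (s + t) = h s + h t" for s t
    by (simp add: h_def add algebra_simps)
  have h_nat: "h (real n * s) = real n * h s" for n s
    using h_add[of 0 0] by (induction n) (simp_all add: h_add distrib_right)
  have h_neg: "h (- s) = - h s" for s
    using h_add[of s "- s"] h_add[of 0 0] by simp
  have h_int: "h (of_int k) = 0" for k
  proof -
    have "h (real (nat \<bar>k\<bar>)) = 0"
      using h_nat[of "nat \<bar>k\<bar>" 1] by (simp add: h_def)
    then show ?thesis
      using h_neg[of "of_int k"] by (cases "k \<ge> 0") auto
  qed
  have bounded: "\<bar>h s\<bar> \<le> M + \<bar>g 1\<bar>" for s
  proof -
    have "h s = h (frac s)"
      using h_add[of "frac s" "of_int \<lfloor>s\<rfloor>"] h_int[of "\<lfloor>s\<rfloor>"] by (simp add: frac_def)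
    moreover have "\<bar>g (frac s)\<bar> \<le> M"
      by (rule bd) (simp_all add: frac_ge_0 less_imp_le[OF frac_lt_1])
    moreover have "\<bar>frac s * g 1\<bar> \<le> 1 * \<bar>g 1\<bar>"
      unfolding abs_mult by (intro mult_right_mono) (simp_all add: less_imp_le[OF frac_lt_1])
    ultimately show ?thesis by (simp add: h_def)
  qed
  have "h t = 0"
  proof (rule ccontr)
    assume "h t \<noteq> 0"
    then obtain n :: nat where "M + \<bar>g 1\<bar> < real n * \<bar>h t\<bar>"
      using reals_Archimedean3[of "\<bar>h t\<bar>"] by auto
    then show False
      using bounded[of "real n * t"] by (simp add: h_nat abs_mult)
  qed
  then show ?thesis by (simp add: h_def)
qed

text \<open>The Jordan--von Neumann argument, followed by the Riesz representation of the polar form.\<close>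

lemma hilbert_form_exists_operator:
  fixes q :: "'a::complex_hilbert_space \<Rightarrow> real"
  assumes "hilbert_form q"
  shows "\<exists>T\<in>\<B>\<^sub>+. \<forall>x. quad T x = q x"
proof -
  have par: "q (x + y) + q (x - y) = 2 * q x + 2 * q y" and scale: "q (r *\<^sub>R x) = r\<^sup>2 * q x"
    and i: "q (\<i> *\<^sub>C x) = q x" and nonneg: "0 \<le> q x" for r x y
    using assms unfolding hilbert_form_def by blast+
  obtain M where M: "\<And>x. q x \<le> M * (norm x)\<^sup>2"
    using assms unfolding hilbert_form_def by blast
  have neg: "q (- x) = q x" for x
    using scale[of "-1" x] by simp
  have zero: "q 0 = 0"
    using scale[of 0 0] by simp
  define b where "b x y = (q (x + y) - q (x - y)) / 4" for x y
  have b_self: "b x x = q x" for x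
    using scale[of 2 x] by (simp add: b_def zero scaleR_2)
  have b_sym: "b x y = b y x" for x y
    using neg[of "x - y"] by (simp add: b_def add.commute)
  have b_le: "\<bar>b x y\<bar> \<le> (q x + q y) / 2" for x y
    using par[of x y] nonneg[of "x + y"] nonneg[of "x - y"] by (simp add: b_def)
  have b_add: "b (x + y) z = b x z + b y z" for x y z
  proof -
    \<comment> \<open>The difference of the parallelogram laws for the pairs \<open>u + w\<close>,
      \<open>v\<close> and \<open>u - w\<close>, \<open>v\<close>; with \<open>u\<close> and
      \<open>v\<close> the half sum and half difference of \<open>x\<close> and \<open>y\<close>,
      this becomes additivity.\<close>
    have sum: "b (u + v) w + b (u - v) w = 2 * b u w" for u v w
      using par[of "u + w" v] par[of "u - w" v]
      by (simp add: b_def algebra_simps add_divide_distrib diff_divide_distrib)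
    have half: "b (2 *\<^sub>R u) w = 2 * b u w" for u w
      using sum[of u u w] neg[of w] by (simp add: b_def scaleR_2)
    have "b x z + b y z = 2 * b ((1/2) *\<^sub>R (x + y)) z"
      using sum[of "(1/2) *\<^sub>R (x + y)" "(1/2) *\<^sub>R (x - y)" z]
      by (simp add: scaleR_right_distrib scaleR_right_diff_distrib)
        (simp add: scaleR_left_distrib[symmetric])
    also have "\<dots> = b (x + y) z"
      using half[of "(1/2) *\<^sub>R (x + y)" z] by simp
    finally show ?thesis by simp
  qed
  have b_scale: "b (r *\<^sub>R x) y = r * b x y" for r x y
  proof -
    have "b (r *\<^sub>R x) y = r * b (1 *\<^sub>R x) y"
    proof (rule additive_bounded_linear_real)
      show "b ((s + t) *\<^sub>R x) y = b (s *\<^sub>R x) y + b (t *\<^sub>R x) y" for s t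
        by (simp add: scaleR_left_distrib b_add)
      show "\<bar>b (t *\<^sub>R x) y\<bar> \<le> (q x + q y) / 2" if "0 \<le> t" "t \<le> 1" for t
      proof -
        have "t\<^sup>2 * q x \<le> 1 * q x"
          using that nonneg by (intro mult_right_mono) (auto simp: power_le_one)
        then show ?thesis
          using b_le[of "t *\<^sub>R x" y] by (simp add: scale)
      qed
    qed
    then show ?thesis by simp
  qed
  have b_bound: "\<bar>b x y\<bar> \<le> M * norm x * norm y" for x y
  proof (cases "x = 0 \<or> y = 0")
    case True
    then show ?thesis
      using b_scale[of 0 0 y] b_scale[of 0 0 x] b_sym[of x 0] by auto
  next
    case False
    \<comment> \<open>Normalising both vectors turns the bound by the mean of \<open>q\<close> into
      the constant \<open>M\<close>, and homogeneity then restores the product of the norms.\<close>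
    define u v where "u = (1 / norm x) *\<^sub>R x" and "v = (1 / norm y) *\<^sub>R y"
    have uv: "norm u = 1" "norm v = 1" "x = norm x *\<^sub>R u" "y = norm y *\<^sub>R v"
      using False by (simp_all add: u_def v_def)
    have "b x y = norm x * (norm y * b u v)"
      using uv b_scale b_sym by metis
    moreover have "\<bar>b u v\<bar> \<le> M"
      using b_le[of u v] M[of u] M[of v] uv by simp
    ultimately show ?thesis
      using False by (simp add: abs_mult mult.commute mult_left_mono)
  qed
  have b_right: "b x (y + z) = b x y + b x z" "b x (r *\<^sub>R y) = r * b x y" for x y z r
    using b_add b_scale b_sym by metis+
  have "bounded_linear (b x)" for x
  proof (rule bounded_linear_intro)
    show "norm (b x y) \<le> norm y * (M * norm x)" for y
      using b_bound[of x y] by (simp add: mult_ac)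
  qed (simp_all add: b_right)
  then have "\<forall>x. \<exists>a. \<forall>y. inner a y = b x y"
    using Riesz_representation by blast
  then obtain T where T: "\<And>x y. inner (T x) y = b x y"
    by metis
  have "bounded_linear T"
  proof (rule bounded_linear_intro)
    show "T (x + y) = T x + T y" for x y
      by (rule vector_eq_rdot[THEN iffD1, OF allI]) (simp add: T inner_add_left b_add)
    show "T (r *\<^sub>R x) = r *\<^sub>R T x" for r x
      by (rule vector_eq_rdot[THEN iffD1, OF allI]) (simp add: T b_scale)
    show "norm (T x) \<le> norm x * M" for x
    proof (cases "T x = 0")
      case True
      \<comment> \<open>The sign of \<open>M\<close> is known only through
        \<open>0 \<le> q x \<le> M * (norm x)\<^sup>2\<close> at a nonzero \<open>x\<close>.\<close>
      have "0 \<le> M * norm x" if "x \<noteq> 0"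
        using M[of x] nonneg[of x] that
        by (smt (verit) mult_nonneg_nonneg mult_neg_pos norm_ge_zero zero_less_norm_iff zero_less_power)
      then show ?thesis using True by (cases "x = 0") (auto simp: mult.commute)
    next
      case False
      have "norm (T x) * norm (T x) \<le> M * norm x * norm (T x)"
        using b_bound[of x "T x"] T[of x "T x"]
        by (simp add: power2_norm_eq_inner[symmetric] power2_eq_square)
      then show ?thesis using False by (simp add: mult.commute)
    qed
  qed
  \<comment> \<open>Invariance of \<open>q\<close> makes multiplication by \<open>\<i>\<close> skew
    for \<open>b\<close>. Hence \<open>T\<close> commutes with \<open>\<i>\<close>, and by symmetry
    of \<open>b\<close> the value \<open>inner (T x) (\<i> *\<^sub>C x)\<close> is its own
    negative.\<close>
  moreover have bi: "b (\<i> *\<^sub>C x) y = - b x (\<i> *\<^sub>C y)" for x y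
  proof -
    have "b (\<i> *\<^sub>C x) (\<i> *\<^sub>C \<i> *\<^sub>C y) = b x (\<i> *\<^sub>C y)"
      by (simp only: b_def scaleC_add_right[symmetric] scaleC_diff_right[symmetric] i)
    then show ?thesis
      using b_right(2)[of "\<i> *\<^sub>C x" "-1" y] by (simp add: scaleC_i_i)
  qed
  have "T (\<i> *\<^sub>C x) = \<i> *\<^sub>C T x" for x
    by (rule vector_eq_rdot[THEN iffD1, OF allI]) (simp add: T bi inner_scaleC_i(1) flip: inner_scaleC_i(2))
  moreover have "inner (T x) x \<ge> 0" "inner (T x) (\<i> *\<^sub>C x) = 0" for x
    using bi[of x x] b_sym[of x "\<i> *\<^sub>C x"] by (simp_all add: T b_self nonneg)
  ultimately have "T \<in> \<B>\<^sub>+"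
    by (intro bounded_positiveI)
  moreover have "quad T x = q x" for x
    by (simp add: quad_eq_inner T b_self)
  ultimately show ?thesis by blast
qed

text \<open>Polarisation recovers \<open>inner (S x) y\<close> from the form. This is the uniqueness
  that the definite descriptions require.\<close>

lemma quad_inject:
  fixes S T :: "'a::complex_hilbert_space \<Rightarrow> 'a"
  assumes S: "S \<in> \<B>\<^sub>+" and T: "T \<in> \<B>\<^sub>+" and eq: "\<And>x. quad S x = quad T x"
  shows "S = T"
proof
  fix x
  show "S x = T x"
  proof (rule vector_eq_rdot[THEN iffD1, OF allI])
    show "inner (S x) y = inner (T x) y" for y
      using quad_add[OF S, of x y] quad_add[OF T, of x y] by (simp add: eq)
  qed
qed

lemma the_operator_of_form:
  fixes q :: "'a::complex_hilbert_space \<Rightarrow> real"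
  assumes "hilbert_form q"
  defines "T \<equiv> (THE T. T \<in> \<B>\<^sub>+ \<and> (\<forall>x. quad T x = q x))"
  shows "T \<in> \<B>\<^sub>+" and "quad T x = q x"
proof -
  have "\<exists>!T. T \<in> \<B>\<^sub>+ \<and> (\<forall>x. quad T x = q x)"
    using hilbert_form_exists_operator[OF assms(1)] quad_inject by metis
  from theI'[OF this] show "T \<in> \<B>\<^sub>+" "quad T x = q x"
    unfolding T_def by blast+
qed

text \<open>The laws are assumed for \<open>F\<close> jointly in both variables. Since
  \<open>V\<close> is closed under the same operations, each law passes to the infimum as an
  inequality, and the substitution undoing the operation gives the reverse one.\<close>

lemma hilbert_form_INF:
  fixes F :: "'a::complex_hilbert_space \<Rightarrow> 'a \<Rightarrow> real"
  assumes V: "subspace V" "\<And>y. y \<in> V \<Longrightarrow> \<i> *\<^sub>C y \<in> V"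
    and nonneg: "\<And>x y. 0 \<le> F x y"
    and par: "\<And>x x' y y'. F (x + x') (y + y') + F (x - x') (y - y') = 2 * F x y + 2 * F x' y'"
    and scale: "\<And>r x y. F (r *\<^sub>R x) (r *\<^sub>R y) = r\<^sup>2 * F x y"
    and i: "\<And>x y. F (\<i> *\<^sub>C x) (\<i> *\<^sub>C y) = F x y"
    and bound: "\<And>x. F x 0 \<le> M * (norm x)\<^sup>2"
  shows "hilbert_form (\<lambda>x. INF y\<in>V. F x y)"
proof -
  define q where "q x = (INF y\<in>V. F x y)" for x
  have bdd: "bdd_below (F x ` V)" for x
    using nonneg by (intro bdd_belowI[of _ 0]) auto
  have V0: "0 \<in> V" using V(1) by (rule subspace_0)
  then have ne: "V \<noteq> {}" by blast
  have lower: "q x \<le> F x y" if "y \<in> V" for x y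
    unfolding q_def using bdd that by (rule cINF_lower)
  have greatest: "c \<le> q x" if "\<And>y. y \<in> V \<Longrightarrow> c \<le> F x y" for c x
    unfolding q_def using ne that by (rule cINF_greatest)
  have q_nonneg: "0 \<le> q x" for x
    using nonneg by (rule greatest)
  have scale_le: "r\<^sup>2 * q x \<le> q (r *\<^sub>R x)" for r x
  proof (rule greatest)
    fix y assume "y \<in> V"
    show "r\<^sup>2 * q x \<le> F (r *\<^sub>R x) y"
    proof (cases "r = 0")
      case False
      have "q x \<le> F x ((1/r) *\<^sub>R y)"
        using V(1) \<open>y \<in> V\<close> by (intro lower subspace_scale)
      then show ?thesis
        using scale[of r x "(1/r) *\<^sub>R y"] False by (simp add: mult_left_mono)
    qed (simp add: nonneg)
  qed
  have q_scale: "q (r *\<^sub>R x) = r\<^sup>2 * q x" for r x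
  proof (cases "r = 0")
    case True
    have "F 0 0 = 0" using scale[of 0 0 0] by simp
    then have "q 0 = 0" using lower[OF V0, of 0] q_nonneg[of 0] by simp
    then show ?thesis using True by simp
  next
    case False
    have "(1/r)\<^sup>2 * q (r *\<^sub>R x) \<le> q x"
      using scale_le[of "1/r" "r *\<^sub>R x"] False by simp
    then have "q (r *\<^sub>R x) \<le> r\<^sup>2 * q x"
      using False by (simp add: field_simps)
    with scale_le[of r x] show ?thesis by simp
  qed
  have i_le: "q (\<i> *\<^sub>C x) \<le> q x" for x
    by (rule greatest) (use lower[of "\<i> *\<^sub>C _" "\<i> *\<^sub>C x"] V(2) i in metis)
  have q_i: "q (\<i> *\<^sub>C x) = q x" for x
    \<comment> \<open>Applying \<open>i_le\<close> twice leads to \<open>- x\<close>, where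
      \<open>q\<close> has the same value as at \<open>x\<close>.\<close>
    using i_le[of x] i_le[of "\<i> *\<^sub>C x"] q_scale[of "-1" x] by (simp add: scaleC_i_i)
  have par_le: "q (x + x') + q (x - x') \<le> 2 * q x + 2 * q x'" for x x'
  proof -
    \<comment> \<open>The points \<open>y + y'\<close> and \<open>y - y'\<close> compete on the
      left; the infimum is taken over \<open>y\<close> first, with \<open>y'\<close> fixed, and over
      \<open>y'\<close> afterwards.\<close>
    have "(q (x + x') + q (x - x') - 2 * F x' y') / 2 \<le> q x" if "y' \<in> V" for y'
    proof (rule greatest)
      fix y assume "y \<in> V"
      then show "(q (x + x') + q (x - x') - 2 * F x' y') / 2 \<le> F x y"
        using par[of x x' y y'] lower[of "y + y'" "x + x'"] lower[of "y - y'" "x - x'"]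
          subspace_add[OF V(1) _ that] subspace_diff[OF V(1) _ that] by fastforce
    qed
    then have "(q (x + x') + q (x - x') - 2 * q x) / 2 \<le> q x'"
      by (intro greatest) (fastforce simp: field_simps)
    then show ?thesis by simp
  qed
  have q_par: "q (x + x') + q (x - x') = 2 * q x + 2 * q x'" for x x'
    \<comment> \<open>The inequality at \<open>x + x'\<close> and \<open>x - x'\<close> involves
      \<open>q (2 *\<^sub>R x) = 4 * q x\<close>, and so is the converse inequality at
      \<open>x\<close> and \<open>x'\<close>.\<close>
    using par_le[of x x'] par_le[of "x + x'" "x - x'"] q_scale[of 2 x] q_scale[of 2 x']
    by (simp add: scaleR_2)
  have "q x \<le> M * (norm x)\<^sup>2" for x
    using lower[OF V0, of x] bound[of x] by simp
  then have "hilbert_form q"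
    unfolding hilbert_form_def using q_par q_scale q_i q_nonneg by blast
  then show ?thesis by (simp add: q_def[abs_def])
qed

text \<open>All laws are equations or weak inequalities, so they survive pointwise limits. The bound
  is assumed for the limit itself, as the constants of the \<open>q n\<close> may vary with
  \<open>n\<close>.\<close>

lemma hilbert_form_limit:
  fixes q :: "nat \<Rightarrow> 'a::complex_hilbert_space \<Rightarrow> real"
  assumes form: "\<And>n. hilbert_form (q n)" and lim: "\<And>x. (\<lambda>n. q n x) \<longlonglongrightarrow> p x"
    and bound: "\<And>x. p x \<le> M * (norm x)\<^sup>2"
  shows "hilbert_form p"
proof -
  have par: "q n (x + y) + q n (x - y) = 2 * q n x + 2 * q n y"
    and scale: "q n (r *\<^sub>R x) = r\<^sup>2 * q n x"
    and i: "q n (\<i> *\<^sub>C x) = q n x" and nonneg: "0 \<le> q n x" for n r x y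
    using form unfolding hilbert_form_def by blast+
  have "p (x + y) + p (x - y) = 2 * p x + 2 * p y" for x y
  proof (rule LIMSEQ_unique)
    show "(\<lambda>n. q n (x + y) + q n (x - y)) \<longlonglongrightarrow> p (x + y) + p (x - y)"
      by (intro tendsto_intros lim)
    show "(\<lambda>n. q n (x + y) + q n (x - y)) \<longlonglongrightarrow> 2 * p x + 2 * p y"
      unfolding par by (intro tendsto_intros lim)
  qed
  moreover have "p (r *\<^sub>R x) = r\<^sup>2 * p x" for r x
  proof (rule LIMSEQ_unique)
    show "(\<lambda>n. q n (r *\<^sub>R x)) \<longlonglongrightarrow> p (r *\<^sub>R x)" by (rule lim)
    show "(\<lambda>n. q n (r *\<^sub>R x)) \<longlonglongrightarrow> r\<^sup>2 * p x"
      unfolding scale by (intro tendsto_intros lim)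
  qed
  moreover have "p (\<i> *\<^sub>C x) = p x" for x
    using LIMSEQ_unique[OF lim[of "\<i> *\<^sub>C x"]] lim[of x] by (simp add: i)
  moreover have "0 \<le> p x" for x
    using lim by (rule LIMSEQ_le_const) (simp add: nonneg)
  ultimately show ?thesis
    unfolding hilbert_form_def using bound by blast
qed

section \<open>The parts of an operator\<close>

lemma quad_bounded:
  assumes "T \<in> \<B>\<^sub>+"
  obtains M where "\<And>x. quad T x \<le> M * (norm x)\<^sup>2"
  using hilbert_form_quad[OF assms] unfolding hilbert_form_def by blast

lemma quad_parallelogram:
  assumes "T \<in> \<B>\<^sub>+"
  shows "quad T (x + y) + quad T (x - y) = 2 * quad T x + 2 * quad T y"
  using hilbert_form_quad[OF assms] unfolding hilbert_form_def by blast

lemma quad_scaleC_i: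
  assumes "T \<in> \<B>\<^sub>+"
  shows "quad T (\<i> *\<^sub>C x) = quad T x"
  using hilbert_form_quad[OF assms] unfolding hilbert_form_def by blast

lemma bounded_positive_scaleR:
  fixes T :: "'a::complex_hilbert_space \<Rightarrow> 'a"
  assumes T: "T \<in> \<B>\<^sub>+" and c: "0 \<le> c"
  shows "(\<lambda>x. c *\<^sub>R T x) \<in> \<B>\<^sub>+"
proof (rule bounded_positiveI)
  show "bounded_linear (\<lambda>x. c *\<^sub>R T x)"
    using bounded_positiveD(1)[OF T] by (rule bounded_linear_const_scaleR)
  show "c *\<^sub>R T (\<i> *\<^sub>C x) = \<i> *\<^sub>C c *\<^sub>R T x" for x
    by (simp add: bounded_positiveD(2)[OF T] scaleR_scaleC scaleC_scaleC mult.commute)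
qed (simp_all add: c bounded_positiveD[OF T])

lemma bounded_positive_id: "(\<lambda>x::'a::complex_hilbert_space. x) \<in> \<B>\<^sub>+"
  by (rule bounded_positiveI)
    (simp_all add: inner_scaleC_i(2) cinner_self bounded_linear_ident)

lemma quad_scaleR_operator: "quad (\<lambda>z. c *\<^sub>R T z) x = c * quad T x"
  by (simp add: quad_eq_inner)

lemma quad_id: "quad (\<lambda>x. x) x = (norm x)\<^sup>2"
  by (simp add: quad_eq_inner power2_norm_eq_inner)

lemma dominated_iff: "A \<le>\<^sub>d B \<longleftrightarrow> (\<exists>c. \<forall>x. quad A x \<le> c * quad B x)"
  by (simp add: dominated_def op_le_def quad_scaleR_operator)

text \<open>Since \<open>quad B\<close> is nonnegative, the constant may be raised to
  \<open>max c 1\<close>; a positive one can be divided by.\<close>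

lemma dominatedE_pos:
  assumes "A \<le>\<^sub>d B" "B \<in> \<B>\<^sub>+"
  obtains c where "c > 0" "\<And>x. quad A x \<le> c * quad B x"
proof -
  obtain c where c: "\<And>x. quad A x \<le> c * quad B x"
    using assms(1) unfolding dominated_iff by blast
  have "quad A x \<le> max c 1 * quad B x" for x
    using c[of x] mult_right_mono[of c "max c 1" "quad B x"] quad_nonneg[OF assms(2), of x]
    by simp
  with that[of "max c 1"] show thesis by simp
qed

lemma subspace_op_ker:
  assumes "B \<in> \<B>\<^sub>+"
  shows "subspace (op_ker B)" "closed (op_ker B)" "y \<in> op_ker B \<Longrightarrow> c *\<^sub>C y \<in> op_ker B"
proof -
  interpret B: bounded_linear B by (rule bounded_positiveD[OF assms])
  show "subspace (op_ker B)"
    by (simp add: op_ker_def subspace_def B.zero B.add B.scaleR)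
  show "closed (op_ker B)"
    unfolding op_ker_def by (intro closed_Collect_eq B.continuous_on continuous_intros)
  show "y \<in> op_ker B \<Longrightarrow> c *\<^sub>C y \<in> op_ker B"
    by (simp add: op_ker_def bounded_positiveD(2)[OF assms] scaleC_zero_right)
qed

lemma quad_diff_op_ker:
  assumes "B \<in> \<B>\<^sub>+" "k \<in> op_ker B"
  shows "quad B (x - k) = quad B x"
  using assms quad_diff[of B x k] bounded_positive_sym[of B x k]
  by (simp add: op_ker_def quad_eq_inner)

lemma ll_part_form:
  fixes A B :: "'a::complex_hilbert_space \<Rightarrow> 'a"
  assumes A: "A \<in> \<B>\<^sub>+" and B: "B \<in> \<B>\<^sub>+"
  shows "ll_part A B \<in> \<B>\<^sub>+"
    and "quad (ll_part A B) x = (INF y\<in>op_ker B. quad A (x - y))"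
proof -
  obtain M where "\<And>x. quad A x \<le> M * (norm x)\<^sup>2"
    using quad_bounded[OF A] by blast
  moreover have "quad A (x + x' - (y + y')) + quad A (x - x' - (y - y'))
      = 2 * quad A (x - y) + 2 * quad A (x' - y')" for x x' y y'
    using quad_parallelogram[OF A, of "x - y" "x' - y'"] by (simp add: algebra_simps)
  ultimately have *: "hilbert_form (\<lambda>x. INF y\<in>op_ker B. quad A (x - y))"
    using subspace_op_ker[OF B]
    by (intro hilbert_form_INF[where M = M])
      (simp_all add: quad_nonneg[OF A] quad_scaleR[OF A] quad_scaleC_i[OF A]
        flip: scaleR_right_diff_distrib scaleC_diff_right)
  show "ll_part A B \<in> \<B>\<^sub>+" "quad (ll_part A B) x = (INF y\<in>op_ker B. quad A (x - y))"
    using the_operator_of_form[OF *] by (simp_all add: ll_part_def)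
qed

lemma parallel_sum_form:
  fixes A B :: "'a::complex_hilbert_space \<Rightarrow> 'a"
  assumes A: "A \<in> \<B>\<^sub>+" and B: "B \<in> \<B>\<^sub>+"
  shows "parallel_sum A B \<in> \<B>\<^sub>+"
    and "quad (parallel_sum A B) x = (INF y. quad A (x - y) + quad B y)"
proof -
  obtain M where "\<And>x. quad A x \<le> M * (norm x)\<^sup>2"
    using quad_bounded[OF A] by blast
  moreover have "quad B 0 = 0"
    using quad_scaleR[OF B, of 0 0] by simp
  moreover have "quad A (x + x' - (y + y')) + quad B (y + y')
      + (quad A (x - x' - (y - y')) + quad B (y - y'))
      = 2 * (quad A (x - y) + quad B y) + 2 * (quad A (x' - y') + quad B y')" for x x' y y'
    using quad_parallelogram[OF A, of "x - y" "x' - y'"] quad_parallelogram[OF B, of y y']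
    by (simp add: algebra_simps)
  ultimately have *: "hilbert_form (\<lambda>x. INF y. quad A (x - y) + quad B y)"
    by (intro hilbert_form_INF[where M = M])
      (simp_all add: quad_nonneg[OF A] quad_nonneg[OF B] quad_scaleR[OF A] quad_scaleR[OF B]
        quad_scaleC_i[OF A] quad_scaleC_i[OF B] distrib_left
        flip: scaleR_right_diff_distrib scaleC_diff_right)
  show "parallel_sum A B \<in> \<B>\<^sub>+"
    "quad (parallel_sum A B) x = (INF y. quad A (x - y) + quad B y)"
    using the_operator_of_form[OF *] by (simp_all add: parallel_sum_def)
qed

lemma ll_part_le:
  assumes "A \<in> \<B>\<^sub>+" "B \<in> \<B>\<^sub>+" "k \<in> op_ker B"
  shows "quad (ll_part A B) x \<le> quad A (x - k)"
  unfolding ll_part_form[OF assms(1,2)]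
  by (rule cINF_lower) (auto intro!: bdd_belowI[of _ 0] quad_nonneg assms)

lemma ll_part_greatest:
  assumes "A \<in> \<B>\<^sub>+" "B \<in> \<B>\<^sub>+" "\<And>k. k \<in> op_ker B \<Longrightarrow> c \<le> quad A (x - k)"
  shows "c \<le> quad (ll_part A B) x"
  unfolding ll_part_form[OF assms(1,2)]
  using subspace_0[OF subspace_op_ker(1)[OF assms(2)]] assms(3) by (intro cINF_greatest) auto

section \<open>Parallel sums with multiples of \<open>B\<close> and their supremum\<close>

context
  fixes A B :: "'a::complex_hilbert_space \<Rightarrow> 'a"
  assumes A: "A \<in> \<B>\<^sub>+" and B: "B \<in> \<B>\<^sub>+"
begin

abbreviation ando_seq :: "nat \<Rightarrow> 'a \<Rightarrow> 'a"
  where "ando_seq n \<equiv> parallel_sum A (\<lambda>z. real n *\<^sub>R B z)"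

lemma ando_seq_form:
  "ando_seq n \<in> \<B>\<^sub>+" "quad (ando_seq n) x = (INF y. quad A (x - y) + real n * quad B y)"
  using parallel_sum_form[OF A bounded_positive_scaleR[OF B, of "real n"]]
  by (simp_all add: quad_scaleR_operator)

lemma ando_seq_le: "quad (ando_seq n) x \<le> quad A (x - y) + real n * quad B y"
  unfolding ando_seq_form
  by (rule cINF_lower) (auto intro!: bdd_belowI[of _ 0] add_nonneg_nonneg quad_nonneg A B mult_nonneg_nonneg)

lemma ando_seq_greatest:
  "(\<And>y. c \<le> quad A (x - y) + real n * quad B y) \<Longrightarrow> c \<le> quad (ando_seq n) x"
  unfolding ando_seq_form by (rule cINF_greatest) auto

lemma ando_seq_mono: "m \<le> n \<Longrightarrow> quad (ando_seq m) x \<le> quad (ando_seq n) x"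
proof (rule ando_seq_greatest)
  fix y
  assume "m \<le> n"
  then have "real m * quad B y \<le> real n * quad B y"
    by (simp add: mult_right_mono quad_nonneg[OF B])
  with ando_seq_le[of m x y] show "quad (ando_seq m) x \<le> quad A (x - y) + real n * quad B y"
    by simp
qed

text \<open>On the kernel of \<open>B\<close> the penalty \<open>real n * quad B k\<close> vanishes,
  so the infimum defining \<open>ll_part\<close> runs over fewer competitors with the same
  values.\<close>

lemma ando_seq_le_ll_part: "quad (ando_seq n) x \<le> quad (ll_part A B) x"
proof (rule ll_part_greatest[OF A B])
  fix k assume "k \<in> op_ker B"
  then show "quad (ando_seq n) x \<le> quad A (x - k)"
    using ando_seq_le[of n x k] by (simp add: op_ker_def quad_eq_inner)
qed

lemma bdd_above_ando_seq: "bdd_above (range (\<lambda>n. quad (ando_seq n) x))"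
  using ando_seq_le_ll_part by (intro bdd_aboveI2)

text \<open>The supremum of the increasing forms is their pointwise limit, and
  \<open>ll_part A B\<close> bounds them independently of \<open>n\<close>.\<close>

lemma ando_part_form:
  "ando_part B A \<in> \<B>\<^sub>+" "quad (ando_part B A) x = (SUP n. quad (ando_seq n) x)"
proof -
  obtain M where M: "\<And>x. quad (ll_part A B) x \<le> M * (norm x)\<^sup>2"
    using quad_bounded[OF ll_part_form(1)[OF A B]] by blast
  have *: "hilbert_form (\<lambda>x. SUP n. quad (ando_seq n) x)"
  proof (rule hilbert_form_limit)
    show "hilbert_form (quad (ando_seq n))" for n
      by (intro hilbert_form_quad ando_seq_form)
    show "(\<lambda>n. quad (ando_seq n) x) \<longlonglongrightarrow> (SUP n. quad (ando_seq n) x)" for x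
      by (intro LIMSEQ_incseq_SUP bdd_above_ando_seq) (simp add: incseq_def ando_seq_mono)
    show "(SUP n. quad (ando_seq n) x) \<le> M * (norm x)\<^sup>2" for x
      using order_trans[OF ando_seq_le_ll_part M] by (intro cSUP_least) auto
  qed
  show "ando_part B A \<in> \<B>\<^sub>+" "quad (ando_part B A) x = (SUP n. quad (ando_seq n) x)"
    using the_operator_of_form[OF *] by (simp_all add: ando_part_def)
qed

lemma ando_seq_le_ando_part: "quad (ando_seq n) x \<le> quad (ando_part B A) x"
  unfolding ando_part_form using bdd_above_ando_seq by (intro cSUP_upper) auto

lemma ando_part_le_ll_part: "quad (ando_part B A) x \<le> quad (ll_part A B) x"
  unfolding ando_part_form using ando_seq_le_ll_part by (intro cSUP_least) auto

text \<open>
  If \<open>quad (ll_part A B) \<le> c * quad B\<close>, then splitting \<open>x = (x - y) + y\<close> and weighting the two parts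
  by \<open>1 + t\<close> and \<open>1 + 1 / t\<close> with \<open>t = c / n\<close> bounds \<open>quad (ll_part A B) x\<close> by
  \<open>(1 + c / n) * quad (ando_seq n) x\<close>.
\<close>

lemma ando_part_eq_ll_part:
  assumes dom: "ll_part A B \<le>\<^sub>d B"
  shows "ando_part B A = ll_part A B"
proof (rule quad_inject)
  show "ando_part B A \<in> \<B>\<^sub>+" by (rule ando_part_form)
  show L: "ll_part A B \<in> \<B>\<^sub>+" by (rule ll_part_form[OF A B])
  fix x
  let ?L = "quad (ll_part A B)" and ?D = "quad (ando_part B A) x"
  obtain c where c: "c > 0" "\<And>x. ?L x \<le> c * quad B x"
    using dominatedE_pos[OF dom B] by blast
  have bound: "?L x \<le> ?D + c * ?D / real n" if "n > 0" for n
  proof -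
    define t where "t = c / real n"
    have t: "t > 0" "real n * t = c" using c that by (simp_all add: t_def)
    have "?L x / (1 + t) \<le> quad (ando_seq n) x"
    proof (rule ando_seq_greatest)
      fix y
      have "?L (x - y) \<le> quad A (x - y)"
        using ll_part_le[OF A B subspace_0[OF subspace_op_ker(1)[OF B]]] by simp
      moreover have "?L y \<le> t * (real n * quad B y)"
        using c(2)[of y] t(2) by (simp add: mult.assoc[symmetric] mult.commute[of t])
      moreover have "t * ?L x \<le> t * ((1 + t) * ?L (x - y)) + (1 + t) * ?L y"
      proof -
        \<comment> \<open>This square gives the weighted inequality multiplied by \<open>t\<close>,
          which avoids the quotient \<open>1 / t\<close>.\<close>
        have "0 \<le> ?L (t *\<^sub>R (x - y) - y)" by (rule quad_nonneg[OF L])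
        also have "\<dots> = t\<^sup>2 * ?L (x - y) + ?L y - t * (2 * inner (ll_part A B (x - y)) y)"
          using bounded_positiveD(1)[OF L]
          by (simp add: quad_diff[OF L] quad_scaleR[OF L] linear_simps)
        also have "2 * inner (ll_part A B (x - y)) y = ?L x - ?L (x - y) - ?L y"
          using quad_add[OF L, of "x - y" y] by simp
        finally show ?thesis by (simp add: algebra_simps power2_eq_square)
      qed
      ultimately have "t * ?L x \<le> t * ((1 + t) * quad A (x - y)) + (1 + t) * (t * (real n * quad B y))"
        using t(1)
        by (smt (verit) mult_left_mono)
      then have "t * ?L x \<le> t * ((1 + t) * (quad A (x - y) + real n * quad B y))"
        by (simp add: algebra_simps)
      then have "?L x \<le> (1 + t) * (quad A (x - y) + real n * quad B y)"
        using t(1) by (simp only: mult_le_cancel_left_pos)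
      then show "?L x / (1 + t) \<le> quad A (x - y) + real n * quad B y"
        using t(1) by (simp add: field_simps)
    qed
    also have "\<dots> \<le> ?D" by (rule ando_seq_le_ando_part)
    finally have "?L x \<le> ?D * (1 + t)" using t(1) by (simp add: field_simps)
    then show ?thesis by (simp add: t_def algebra_simps)
  qed
  have "(\<lambda>n. ?D + c * ?D / real n) \<longlonglongrightarrow> ?D + 0"
    by (intro tendsto_add tendsto_const lim_const_over_n)
  then have "?L x \<le> ?D + 0"
    by (rule LIMSEQ_le_const) (use bound in \<open>auto intro!: exI[of _ 1]\<close>)
  with ando_part_le_ll_part[of x] show "?D = ?L x" by simp
qed

end

section \<open>Closed range\<close>

lemma closed_range_imp_dist_op_ker_le:
  fixes B :: "'a::complex_hilbert_space \<Rightarrow> 'a"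
  assumes B: "B \<in> \<B>\<^sub>+" and closed: "closed (range B)"
  obtains C where "\<And>x. \<exists>k\<in>op_ker B. (norm (x - k))\<^sup>2 \<le> C * quad B x"
proof -
  interpret B: bounded_linear B by (rule bounded_positiveD[OF B])
  define K where "K = {x. (\<forall>k\<in>op_ker B. inner x k = 0) \<and> quad B x \<le> 1}"
  have "\<exists>M. \<forall>x\<in>K. \<bar>inner x z\<bar> \<le> M" for z
  proof -
    \<comment> \<open>Closedness of the range enters here: \<open>z\<close> has a projection
      \<open>B w\<close> on it. The remainder is orthogonal to the range, hence in the kernel by
      symmetry of \<open>B\<close>, and is invisible to \<open>x\<close> in
      \<open>K\<close>.\<close>
    have "subspace (range B)"
      by (auto intro: linear_subspace_image[OF B.linear subspace_UNIV])
    then obtain w where w: "\<And>v. inner (z - B w) (B v) = 0"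
      using orthogonal_projection_exists[OF _ closed, of z] by blast
    have "B (z - B w) = 0"
      using w[of "B (z - B w)"] bounded_positive_sym[OF B, of "z - B w" "B (z - B w)"]
      by (metis inner_eq_zero_iff)
    then have ker: "z - B w \<in> op_ker B" by (simp add: op_ker_def)
    have "\<bar>inner x z\<bar> \<le> (1 + quad B w) / 2" if "x \<in> K" for x
    proof -
      have "inner x (z - B w) = 0" using that ker by (simp add: K_def)
      then have "inner x z = inner (B x) w"
        by (simp add: inner_diff_right bounded_positive_sym[OF B])
      then show ?thesis
        using inner_le_quad[OF B, of x w] that by (simp add: K_def)
    qed
    then show ?thesis by blast
  qed
  then have "bounded K" by (rule weakly_bounded_imp_bounded)
  then obtain R where R: "R > 0" "\<And>x. x \<in> K \<Longrightarrow> norm x \<le> R"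
    by (auto simp: bounded_pos)
  have "\<exists>k\<in>op_ker B. (norm (x - k))\<^sup>2 \<le> R\<^sup>2 * quad B x" for x
  proof -
    obtain k where k: "k \<in> op_ker B" "\<And>v. v \<in> op_ker B \<Longrightarrow> inner (x - k) v = 0"
      using orthogonal_projection_exists[OF subspace_op_ker(1,2)[OF B]] by blast
    have q: "quad B (x - k) = quad B x" by (rule quad_diff_op_ker[OF B k(1)])
    have "(norm (x - k))\<^sup>2 \<le> R\<^sup>2 * quad B x"
    proof (cases "quad B x = 0")
      case True
      then have "B (x - k) = 0" using q quad_eq_0_iff[OF B, of "x - k"] by simp
      \<comment> \<open>Here \<open>x - k\<close> lies both in the kernel and in its orthogonal
        complement.\<close>
      then have "inner (x - k) (x - k) = 0" by (intro k(2)) (simp add: op_ker_def)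
      then show ?thesis using True by simp
    next
      case False
      then have pos: "quad B x > 0" using quad_nonneg[OF B, of x] by simp
      \<comment> \<open>The factor that scales the value of \<open>quad B\<close> to exactly 1,
        placing the scaled vector in \<open>K\<close>.\<close>
      define s where "s = 1 / sqrt (quad B x)"
      have s: "s\<^sup>2 * quad B x = 1" using pos by (simp add: s_def power_divide)
      have "s *\<^sub>R (x - k) \<in> K"
        using k(2) s by (simp add: K_def quad_scaleR[OF B] q)
      then have "(norm (s *\<^sub>R (x - k)))\<^sup>2 \<le> R\<^sup>2"
        by (intro power_mono R(2) norm_ge_zero)
      then have "s\<^sup>2 * (norm (x - k))\<^sup>2 \<le> R\<^sup>2"
        by (simp add: power_mult_distrib)
      then have "quad B x * (s\<^sup>2 * (norm (x - k))\<^sup>2) \<le> quad B x * R\<^sup>2"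
        using pos by (intro mult_left_mono) auto
      moreover have "quad B x * (s\<^sup>2 * (norm (x - k))\<^sup>2) = (norm (x - k))\<^sup>2"
        using s by (metis mult.assoc mult.commute mult_1)
      ultimately show ?thesis by (simp add: mult.commute)
    qed
    with k(1) show ?thesis by blast
  qed
  then show thesis by (rule that)
qed

lemma closed_range_imp_ll_part_dominated:
  assumes A: "A \<in> \<B>\<^sub>+" and B: "B \<in> \<B>\<^sub>+" and "closed (range B)"
  shows "ll_part A B \<le>\<^sub>d B"
proof -
  obtain C where C: "\<And>x. \<exists>k\<in>op_ker B. (norm (x - k))\<^sup>2 \<le> C * quad B x"
    using closed_range_imp_dist_op_ker_le[OF B assms(3)] by blast
  obtain M where M: "\<And>x. quad A x \<le> M * (norm x)\<^sup>2"
    using quad_bounded[OF A] by blast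
  have "quad (ll_part A B) x \<le> \<bar>M\<bar> * C * quad B x" for x
  proof -
    obtain k where k: "k \<in> op_ker B" "(norm (x - k))\<^sup>2 \<le> C * quad B x"
      using C by blast
    have "quad (ll_part A B) x \<le> quad A (x - k)"
      by (rule ll_part_le[OF A B k(1)])
    also have "\<dots> \<le> \<bar>M\<bar> * (norm (x - k))\<^sup>2"
      by (rule order_trans[OF M]) (simp add: mult_right_mono)
    also have "\<dots> \<le> \<bar>M\<bar> * (C * quad B x)"
      using k(2) by (intro mult_left_mono) auto
    finally show ?thesis by (simp add: mult.assoc)
  qed
  then show ?thesis unfolding dominated_iff by blast
qed

section \<open>From domination back to closed range\<close>

text \<open>On the complement \<open>V\<close> of the kernel, subtracting kernel vectors only
  lengthens \<open>x\<close>, so domination makes \<open>B\<close> bounded below there. As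
  \<open>B\<close> maps \<open>V\<close> onto its whole range, convergent sequences in the range
  lift to Cauchy sequences in \<open>V\<close>.\<close>

lemma ll_part_id_dominated_imp_closed_range:
  fixes B :: "'a::complex_hilbert_space \<Rightarrow> 'a"
  assumes B: "B \<in> \<B>\<^sub>+" and dom: "ll_part (\<lambda>x. x) B \<le>\<^sub>d B"
  shows "closed (range B)"
proof -
  interpret B: bounded_linear B by (rule bounded_positiveD[OF B])
  obtain c where c: "c > 0" "\<And>x. quad (ll_part (\<lambda>x. x) B) x \<le> c * quad B x"
    using dominatedE_pos[OF dom B] by blast
  define V where "V = {x. \<forall>k\<in>op_ker B. inner x k = 0}"
  have "subspace V"
    by (auto simp: V_def subspace_def inner_add_left)
  have le: "norm x \<le> c * norm (B x)" if "x \<in> V" for x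
  proof (cases "x = 0")
    case False
    have "(norm x)\<^sup>2 \<le> quad (ll_part (\<lambda>x. x) B) x"
    proof (rule ll_part_greatest[OF bounded_positive_id B])
      fix k assume "k \<in> op_ker B"
      then have "inner x k = 0" using that by (simp add: V_def)
      then show "(norm x)\<^sup>2 \<le> quad (\<lambda>x. x) (x - k)"
        by (simp add: quad_id power2_norm_eq_inner inner_simps inner_commute)
    qed
    also have "\<dots> \<le> c * quad B x" by (rule c(2))
    also have "\<dots> \<le> c * (norm (B x) * norm x)"
      using c(1) norm_cauchy_schwarz[of "B x" x] by (simp add: quad_eq_inner)
    finally show ?thesis using False by (simp add: power2_eq_square)
  qed (simp add: B.zero)
  have range: "\<exists>v\<in>V. B x = B v" for x
  proof -
    obtain k where k: "k \<in> op_ker B" "\<And>v. v \<in> op_ker B \<Longrightarrow> inner (x - k) v = 0"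
      using orthogonal_projection_exists[OF subspace_op_ker(1,2)[OF B]] by blast
    then show ?thesis
      by (intro bexI[of _ "x - k"]) (auto simp: V_def B.diff op_ker_def)
  qed
  show ?thesis
    unfolding closed_sequential_limits
  proof (intro allI impI, elim conjE)
    fix z l assume z: "\<forall>n. z n \<in> range B" and l: "z \<longlonglongrightarrow> l"
    have "\<exists>v\<in>V. z n = B v" for n
      using z range by (metis imageE)
    then obtain v where v: "\<And>n. v n \<in> V" "\<And>n. z n = B (v n)"
      by metis
    have "Cauchy v"
    proof (rule metric_CauchyI)
      fix e :: real assume "0 < e"
      then have "e / c > 0" using c(1) by simp
      then obtain N where N: "\<And>m n. m \<ge> N \<Longrightarrow> n \<ge> N \<Longrightarrow> dist (z m) (z n) < e / c"
        using metric_CauchyD[OF LIMSEQ_imp_Cauchy[OF l]] by blast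
      show "\<exists>M. \<forall>m\<ge>M. \<forall>n\<ge>M. dist (v m) (v n) < e"
      proof (intro exI allI impI)
        fix m n assume "N \<le> m" "N \<le> n"
        have "v m - v n \<in> V" using \<open>subspace V\<close> v(1) by (intro subspace_diff)
        from le[OF this] have "dist (v m) (v n) \<le> c * dist (z m) (z n)"
          by (simp add: dist_norm v(2) B.diff)
        also have "\<dots> < e"
          using N[OF \<open>N \<le> m\<close> \<open>N \<le> n\<close>] c(1) by (simp add: field_simps)
        finally show "dist (v m) (v n) < e" .
      qed
    qed
    then obtain p where "v \<longlonglongrightarrow> p"
      using Cauchy_convergent convergent_def by blast
    then have "z \<longlonglongrightarrow> B p"
      unfolding v(2) by (rule B.tendsto)
    then have "l = B p" using l LIMSEQ_unique by blast
    then show "l \<in> range B" by blast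
  qed
qed

text \<open>
  Near-minimisers of \<open>\<lambda>y. (norm (x - y))\<^sup>2 + n * quad B y\<close> form a Cauchy sequence, whose limit lies
  in the kernel of \<open>B\<close>.
\<close>

lemma ll_part_id_le_ando_part_id:
  fixes B :: "'a::complex_hilbert_space \<Rightarrow> 'a"
  assumes B: "B \<in> \<B>\<^sub>+"
  shows "quad (ll_part (\<lambda>x. x) B) x \<le> quad (ando_part B (\<lambda>x. x)) x"
proof -
  note I = bounded_positive_id[where 'a = 'a]
  interpret B: bounded_linear B by (rule bounded_positiveD[OF B])
  define F where "F n y = (norm (x - y))\<^sup>2 + real n * quad B y" for n :: nat and y
  define d where "d n = quad (ando_seq (\<lambda>x. x) B n) x" for n
  define D where "D = quad (ando_part B (\<lambda>x. x)) x"
  have d_le: "d n \<le> F n y" for n y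
    using ando_seq_le[OF I B, of n x y] by (simp add: d_def F_def quad_id)
  have d_le_D: "d n \<le> D" for n
    unfolding d_def D_def by (rule ando_seq_le_ando_part[OF I B])
  have d_lim: "d \<longlonglongrightarrow> D"
    unfolding d_def D_def ando_part_form[OF I B]
    by (intro LIMSEQ_incseq_SUP bdd_above_ando_seq[OF I B])
      (simp add: incseq_def ando_seq_mono[OF I B])
  \<comment> \<open>Otherwise \<open>D + 1 / real (Suc n)\<close> would be a lower bound of
    \<open>F n\<close>, so that \<open>d n\<close> would exceed \<open>D\<close>.\<close>
  have "\<exists>y. F n y < D + 1 / real (Suc n)" for n
  proof (rule ccontr)
    assume "\<nexists>y. F n y < D + 1 / real (Suc n)"
    then have "D + 1 / real (Suc n) \<le> d n"
      unfolding d_def by (intro ando_seq_greatest[OF I B]) (simp add: F_def quad_id not_less)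
    moreover have "1 / real (Suc n) > 0" by simp
    ultimately show False using d_le_D[of n] by linarith
  qed
  then obtain y where y: "\<And>n. F n (y n) < D + 1 / real (Suc n)"
    by metis
  have lim0: "(\<lambda>n. 1 / real (Suc n)) \<longlonglongrightarrow> 0"
    using LIMSEQ_inverse_real_of_nat by (simp add: inverse_eq_divide)
  have "Cauchy y"
  proof (rule Cauchy_of_norm_le)
    fix m n :: nat
    assume "m \<le> n"
    let ?h = "(1/2) *\<^sub>R (y m + y n)"
    have "4 * quad B ?h = 2 * quad B (y m) + 2 * quad B (y n) - quad B (y m - y n)"
      using quad_parallelogram[OF B, of "y m" "y n"] by (simp add: quad_scaleR[OF B] power2_eq_square)
    then have h: "4 * quad B ?h \<le> 2 * quad B (y m) + 2 * quad B (y n)"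
      using quad_nonneg[OF B, of "y m - y n"] by simp
    have "(norm (y m - y n))\<^sup>2 = 2 * F m (y m) + 2 * F m (y n) - 4 * F m ?h
        - real m * (2 * quad B (y m) + 2 * quad B (y n) - 4 * quad B ?h)"
      unfolding norm_diff_midpoint[of "y m" "y n" x] F_def by (simp add: algebra_simps)
    also have "\<dots> \<le> 2 * F m (y m) + 2 * F m (y n) - 4 * F m ?h"
      using h by simp
    \<comment> \<open>The penalty grows with the index, so \<open>y n\<close>, chosen at level
      \<open>n\<close>, is still nearly minimal at level \<open>m\<close>.\<close>
    also have "F m (y n) \<le> F n (y n)"
      using \<open>m \<le> n\<close> quad_nonneg[OF B] by (simp add: F_def mult_right_mono)
    also have "2 * F m (y m) + 2 * F n (y n) - 4 * F m ?h
        \<le> 4 * (D - d m) + 2 * (1 / real (Suc m)) + 2 * (1 / real (Suc n))"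
      using y[of m] y[of n] d_le[of m ?h] by argo
    also have "\<dots> \<le> 4 * (D - d m) + 4 * (1 / real (Suc m))"
      using frac_le[of 1 1 "real (Suc m)" "real (Suc n)"] \<open>m \<le> n\<close> by simp
    finally show "(norm (y m - y n))\<^sup>2 \<le> 4 * (D - d m) + 4 * (1 / real (Suc m))" by simp
  next
    have "(\<lambda>m. 4 * (D - d m) + 4 * (1 / real (Suc m))) \<longlonglongrightarrow> 4 * (D - D) + 4 * 0"
      by (intro tendsto_intros d_lim lim0)
    then show "(\<lambda>m. 4 * (D - d m) + 4 * (1 / real (Suc m))) \<longlonglongrightarrow> 0" by simp
  qed
  then obtain k where k: "y \<longlonglongrightarrow> k"
    using Cauchy_convergent convergent_def by blast
  have quad_lim: "(\<lambda>n. quad B (y n)) \<longlonglongrightarrow> quad B k"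
    unfolding quad_eq_inner by (intro tendsto_intros B.tendsto k)
  have y': "(norm (x - y n))\<^sup>2 \<le> D + 1 / real (Suc n)" "real n * quad B (y n) \<le> D + 1" for n
  proof -
    have "1 / real (Suc n) \<le> 1" by simp
    moreover have "0 \<le> real n * quad B (y n)"
      using quad_nonneg[OF B] by simp
    moreover have "0 \<le> (norm (x - y n))\<^sup>2" by simp
    ultimately show "(norm (x - y n))\<^sup>2 \<le> D + 1 / real (Suc n)" "real n * quad B (y n) \<le> D + 1"
      using y[of n] unfolding F_def by linarith+
  qed
  have "(norm (x - k))\<^sup>2 \<le> D + 0"
    by (rule LIMSEQ_le[of "\<lambda>n. (norm (x - y n))\<^sup>2" _ "\<lambda>n. D + 1 / real (Suc n)"])
      (intro tendsto_intros k lim0 exI allI impI y')+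
  \<comment> \<open>The penalties \<open>real n * quad B (y n)\<close> stay bounded, so
    \<open>quad B (y n)\<close> tends to zero.\<close>
  moreover have "quad B k \<le> 0"
  proof (rule LIMSEQ_le[OF quad_lim])
    show "(\<lambda>n. (D + 1) / real n) \<longlonglongrightarrow> 0" by (rule lim_const_over_n)
    show "\<exists>N. \<forall>n\<ge>N. quad B (y n) \<le> (D + 1) / real n"
      using y'(2) by (intro exI[of _ 1]) (simp add: field_simps)
  qed
  then have "k \<in> op_ker B"
    using quad_nonneg[OF B, of k] quad_eq_0_iff[OF B, of k] by (simp add: op_ker_def)
  then have "quad (ll_part (\<lambda>x. x) B) x \<le> (norm (x - k))\<^sup>2"
    using ll_part_le[OF I B, of k x] by (simp add: quad_id)
  ultimately show ?thesis by (simp add: D_def)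
qed

theorem corollary2p3:
  fixes B :: "'a::complex_hilbert_space \<Rightarrow> 'a"
  assumes "B \<in> \<B>\<^sub>+"
  shows "(closed (range B) \<longleftrightarrow> (\<forall>A\<in>\<B>\<^sub>+. ll_part A B \<le>\<^sub>d B))
    \<and> (closed (range B) \<longleftrightarrow> (\<forall>A\<in>\<B>\<^sub>+. ando_part B A \<le>\<^sub>d B))
    \<and> (closed (range B) \<or> (\<forall>A\<in>\<B>\<^sub>+. ll_part A B \<le>\<^sub>d B) \<or> (\<forall>A\<in>\<B>\<^sub>+. ando_part B A \<le>\<^sub>d B)
        \<longrightarrow> (\<forall>A\<in>\<B>\<^sub>+. ando_part B A = ll_part A B))"
proof -
  have ii: "\<forall>A\<in>\<B>\<^sub>+. ll_part A B \<le>\<^sub>d B" if "closed (range B)"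
    using closed_range_imp_ll_part_dominated[OF _ assms that] by blast
  have eq: "\<forall>A\<in>\<B>\<^sub>+. ando_part B A = ll_part A B" if "closed (range B)"
    using ando_part_eq_ll_part[OF _ assms] ii[OF that] by blast
  \<comment> \<open>Both converse implications are tested on the identity operator; for the Ando
    part, the comparison with \<open>ll_part\<close> at the identity reduces the second to the
    first.\<close>
  have i: "closed (range B)" if "ll_part (\<lambda>x. x) B \<le>\<^sub>d B"
    using ll_part_id_dominated_imp_closed_range[OF assms that] .
  have i': "closed (range B)" if "ando_part B (\<lambda>x. x) \<le>\<^sub>d B"
    using that ll_part_id_le_ando_part_id[OF assms] i unfolding dominated_iff
    by (meson order_trans)
  have iii: "\<forall>A\<in>\<B>\<^sub>+. ando_part B A \<le>\<^sub>d B" if "closed (range B)"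
    using ii[OF that] eq[OF that] by simp
  show ?thesis
    using i i' ii iii eq bounded_positive_id[where 'a = 'a] by blast
qed

end
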